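(* Let $\beta>0$, $x\in\mathbb{R}$ and $n\in\mathbb{N}$. (a) Let $f\in\mathcal{S}$, $a=f(x+)=f(x-)$ and $g=f_x$. Then equality holds in $$\left|L_n^{\beta}(f,x) - \frac{f(x+) + f(x-)}{2}\right|\leq |f(x) - f(x-)|\, P(Y_\beta =0) + |f(x+) - f(x-)| \left| P(Y_\beta>0) - \frac{1}{2}\right|+ \mathbb{E}\, \omega \left(g , \frac{X_\beta}{\sqrt{n}} \right).$$ Specifically, $$L_n^{\beta}(f,x)-a=\mathbb{E}\,\omega\left(g,\frac{X_{\beta}}{\sqrt{n}}\right).$$ (b) Let $\widetilde{\phi}\in\widetilde{\mathcal{S}}$, $\widetilde{\phi}(y)=\int_0^{|y-x|}f(x+u)\,du$ with $f\in\mathcal{S}$, and let $a=f(x+)=f(x-)$ and $g=f_x$. Put $h(y)=\operatorname{sgn}(y-x)f(y)$, so that $\widetilde{\phi}(y)=\widetilde{\phi}(x)+\int_x^y h(u)\,du$. Then equality holds in $$\left|L_n^{\beta}(\widetilde{\phi},x)-\widetilde{\phi}(x)-\frac{1}{2\sqrt{n}}(h(x+)+h(x-))\,\mathbb{E}Y_\beta-\frac{1}{2\sqrt{n}}(h(x+)-h(x-))\,\mathbb{E}|Y_\beta|\right|\leq \frac{1}{\beta\sqrt{n}}\,\mathbb{E}\,\omega\left(h_x,\frac{X_{\beta}}{\sqrt{n}}\right).$$ More precisely, $$L_n^{\beta}(\widetilde{\phi},x)-\frac{a}{\beta\sqrt{n}}=\frac{1}{\beta\sqrt{n}}\,\ma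thbb{E}\,\omega\left(g,\frac{X_{\beta}}{\sqrt{n}}\right).$$
   Context: $\mathbb{N}$ is the set of positive integers. $X_\beta$ is a random variable with the exponential distribution of parameter $\beta>0$, i.e. $P(X_\beta\leq y)=1-\exp(-\beta y)$, $y\geq 0$. $Y_\beta$ is a random variable with the symmetric exponential density $\rho_\beta(\theta)=\frac{\beta}{2}\exp(-\beta|\theta|)$, $\theta\in\mathbb{R}$. The convolution operators $L_n^\beta$ are $$L_n^{\beta}(f,x)=\mathbb{E}f\left(x+\frac{Y_{\beta}}{\sqrt{n}}\right),\quad x\in\mathbb{R},\ n\in\mathbb{N},$$ for measurable $f:\mathbb{R}\to\mathbb{R}$ for which the expectations exist. Fix $x\in\mathbb{R}$. $B(\mathbb{R})$ is the set of all measurable bounded functions $f:\mathbb{R}\to\mathbb{R}$ whose right and left limits at $x$, denoted $f(x+)$ and $f(x-)$, exist and are finite. For $f\in B(\mathbb{R})$, $$f_x(y)=(f(y)-f(x+))1_{(x,\infty)}(y)+(f(y)-f(x-))1_{(-\infty,x)}(y),\quad y\in\mathbb{R}$$ ($1_A$ is the indicator function of $A$), so $f_x(x)=0$; and for $k\in B(\mathbb{R})$ $$\omega(k,\theta)=\sup\{|k(x+u)-k(x)|:\ |u|\leq\theta\},\quad\theta\geq 0.$$ $\mathcal{S}\subset B(\mathbb{R})$ is the set of functions $f\in B(\mathbb{R})$ which are symmetric around $x$ (i.e. $f(x+u)=f(x-u)$ for all $u$) and nondecreasing in $[x,\infty)$; for such $f$ one has $f(x+)=f(x-)$. $\widetilde{\mathcal{S}}$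 is the set of functions $\widetilde{\phi}(y)=\int_0^{|y-x|}f(x+u)\,du$, $y\in\mathbb{R}$, with $f\in\mathcal{S}$. Here $\operatorname{sgn}(t)$ equals $1$, $0$, $-1$ according to $t>0$, $t=0$, $t<0$. *)

theory Defs
  imports "HOL-Probability.Probability"
begin

text \<open>Density of the symmetric exponential law of \<open>Y\<^sub>\<beta>\<close>; the law of \<open>X\<^sub>\<beta>\<close> is given by
  \<^const>\<open>exponential_density\<close>.\<close>

definition sym_exp_density :: "real \<Rightarrow> real \<Rightarrow> real" where
  "sym_exp_density \<beta> \<theta> = \<beta> / 2 * exp (- \<beta> * \<bar>\<theta>\<bar>)"

text \<open>\<open>L\<^sub>n\<^sup>\<beta>(f, x)\<close>, for \<open>Y\<close> a random variable on \<open>N\<close> with density \<^term>\<open>sym_exp_density \<beta>\<close>;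
  the parameter \<open>\<beta>\<close> enters only through the law of \<open>Y\<close>.\<close>

definition conv_op :: "'b measure \<Rightarrow> ('b \<Rightarrow> real) \<Rightarrow> nat \<Rightarrow> (real \<Rightarrow> real) \<Rightarrow> real \<Rightarrow> real" where
  "conv_op N Y n f x = (\<integral>w. f (x + Y w / sqrt (real n)) \<partial>N)"

text \<open>One-sided limits; as \<^const>\<open>Lim\<close> is arbitrary when there is no limit, they are
  meaningful only together with the existence of the limit, as provided by \<open>B_class\<close> below.\<close>

definition rlim :: "(real \<Rightarrow> real) \<Rightarrow> real \<Rightarrow> real" where
  "rlim f x = Lim (at_right x) f"

definition llim :: "(real \<Rightarrow> real) \<Rightarrow> real \<Rightarrow> real" where
  "llim f x = Lim (at_left x) f"

definition B_class :: "real \<Rightarrow> (real \<Rightarrow> real) set" where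
  "B_class x = {f. f \<in> borel_measurable borel \<and> bounded (range f) \<and>
     (\<exists>l. (f \<longlongrightarrow> l) (at_right x)) \<and> (\<exists>l. (f \<longlongrightarrow> l) (at_left x))}"

definition centered :: "real \<Rightarrow> (real \<Rightarrow> real) \<Rightarrow> real \<Rightarrow> real" where
  "centered x f y =
     (f y - rlim f x) * indicator {x<..} y + (f y - llim f x) * indicator {..<x} y"

text \<open>Only used for \<open>k\<close> bounded and \<open>\<theta> \<ge> 0\<close>, where the set below is bounded and nonempty.\<close>

definition modulus :: "real \<Rightarrow> (real \<Rightarrow> real) \<Rightarrow> real \<Rightarrow> real" where
  "modulus x k \<theta> = Sup {\<bar>k (x + u) - k x\<bar> | u. \<bar>u\<bar> \<le> \<theta>}"

definition S_class :: "real \<Rightarrow> (real \<Rightarrow> real) set" where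
  "S_class x = {f \<in> B_class x. (\<forall>u. f (x + u) = f (x - u)) \<and> mono_on {x..} f}"

definition tilde :: "real \<Rightarrow> (real \<Rightarrow> real) \<Rightarrow> real \<Rightarrow> real" where
  "tilde x f y = (LBINT u=0..\<bar>y - x\<bar>. f (x + u))"

definition S_tilde :: "real \<Rightarrow> (real \<Rightarrow> real) set" where
  "S_tilde x = {tilde x f | f. f \<in> S_class x}"

end

theory Submission imports Defs begin

text \<open>
  Both parts rest on one fact about the laws: the absolute value of a symmetric exponential
  variable is exponential with the same parameter (lemma \<open>abs_sym_exp_distributed\<close>), and dividing
  by \<open>sqrt n\<close> only replaces the parameter \<open>\<beta>\<close> by \<open>b = \<beta> * sqrt n\<close>. A function that is
  symmetric around \<open>x\<close> sees \<open>Y\<close> only through \<open>\<bar>Y\<bar>\<close>, so that the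
  operator evaluates it at the same law as the one at which the modulus of continuity is averaged.

  For \<open>f\<close> symmetric around \<open>x\<close> and nondecreasing to the right, the function \<open>g = f\<^sub>x\<close> is
  nonnegative, vanishes at \<open>x\<close> and grows with the distance to \<open>x\<close>. Hence the supremum in the
  modulus is attained at the end point, and it equals \<open>f (x + \<theta>) - a\<close> for \<open>\<theta> > 0\<close>
  (lemma \<open>modulus_centered_S_class\<close>). Averaging over the exponential law gives part (a); the two
  remaining terms of the bound vanish as \<open>Y\<close> has no atom at zero and the one-sided limits agree.

  Part (b) reduces to part (a): as \<open>P (X > t) = exp (- b * t)\<close> is the density of
  \<open>X\<close> divided by \<open>b\<close>, Fubini's theorem shows that the mean of a primitive at \<open>X\<close> is
  \<open>1 / b\<close> times the mean of the function (lemma \<open>exponential_expectation_primitive\<close>).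
  The oscillations of \<open>h\<^sub>x\<close> and \<open>f\<^sub>x\<close> around \<open>x\<close> have the same size, so their moduli coincide.
\<close>

section \<open>The exponential laws\<close>

lemma distributed_exponential_divide:
  assumes "prob_space M" and "distributed M lborel X (exponential_density b)" and "c > 0"
  shows "distributed M lborel (\<lambda>w. X w / c) (exponential_density (b * c))"
proof -
  interpret prob_space M by fact
  have "distributed M lborel (\<lambda>w. 0 + (1 / c) * X w)
      (\<lambda>t. ennreal (exponential_density b ((t - 0) / (1 / c))) / ennreal \<bar>1 / c\<bar>)"
    by (rule distributed_affine) (use assms in auto)
  moreover have "ennreal (exponential_density b ((t - 0) / (1 / c))) / ennreal \<bar>1 / c\<bar>
      = ennreal (exponential_density (b * c) t)" for t
  proof (cases "exponential_density b (t * c) \<ge> 0")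
    case True
    then show ?thesis using \<open>c > 0\<close>
      by (simp add: divide_ennreal exponential_density_def mult_less_0_iff mult_ac)
  next
    case False
    then have "b < 0" "t \<ge> 0" using \<open>c > 0\<close>
      by (auto simp: exponential_density_def mult_less_0_iff mult_le_0_iff not_le split: if_splits)
    then have "exponential_density (b * c) t \<le> 0" "exponential_density b (t * c) \<le> 0"
      using \<open>c > 0\<close> by (auto simp: exponential_density_def mult_le_0_iff)
    then show ?thesis by (simp add: ennreal_neg)
  qed
  ultimately show ?thesis by simp
qed

lemma distributed_sym_exp_divide:
  assumes "prob_space N" and "distributed N lborel Y (sym_exp_density b)" and "c > 0" "b > 0"
  shows "distributed N lborel (\<lambda>w. Y w / c) (sym_exp_density (b * c))"
proof -
  interpret prob_space N by fact
  have "distributed N lborel (\<lambda>w. 0 + (1 / c) * Y w)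
      (\<lambda>t. ennreal (sym_exp_density b ((t - 0) / (1 / c))) / ennreal \<bar>1 / c\<bar>)"
    by (rule distributed_affine) (use assms in auto)
  moreover have "ennreal (sym_exp_density b ((t - 0) / (1 / c))) / ennreal \<bar>1 / c\<bar>
      = ennreal (sym_exp_density (b * c) t)" for t
    using \<open>c > 0\<close> \<open>b > 0\<close>
    by (simp add: divide_ennreal sym_exp_density_def abs_mult mult_ac)
  ultimately show ?thesis by simp
qed

text \<open>The symmetric density is the average of the exponential density and its reflection, and the two
  contribute equally to events that depend on the absolute value only. At the origin the average is
  twice too large, so the identity of densities is one almost everywhere.\<close>

lemma abs_sym_exp_distributed:
  assumes Y: "distributed N lborel Y (sym_exp_density b)" and "b > 0"
  shows "distributed N lborel (\<lambda>w. \<bar>Y w\<bar>) (exponential_density b)"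
proof -
  define e where "e t = ennreal (exponential_density b t)" for t
  have [measurable]: "Y \<in> borel_measurable N" "e \<in> borel_measurable borel"
    using distributed_measurable[OF Y] by (auto simp: e_def[abs_def])
  have "distr N lborel (\<lambda>w. \<bar>Y w\<bar>) = density lborel e"
  proof (rule measure_eqI)
    fix A :: "real set" assume "A \<in> sets (distr N lborel (\<lambda>w. \<bar>Y w\<bar>))"
    then have [measurable]: "A \<in> sets borel" by simp
    define F where "F t = e t * indicator A t" for t
    have [measurable]: "F \<in> borel_measurable borel" by (simp add: F_def[abs_def])
    have "emeasure (distr N lborel (\<lambda>w. \<bar>Y w\<bar>)) A = (\<integral>\<^sup>+w. indicator A \<bar>Y w\<bar> \<partial>N)"
      by (subst nn_integral_indicator[symmetric], simp, subst nn_integral_distr) auto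
    also have "\<dots> = (\<integral>\<^sup>+t. ennreal (sym_exp_density b t) * indicator A \<bar>t\<bar> \<partial>lborel)"
      by (rule distributed_nn_integral[OF Y, symmetric]) measurable
    also have "\<dots> = (\<integral>\<^sup>+t. ennreal (1 / 2) * (F t + F (0 + (-1) * t)) \<partial>lborel)"
    proof (rule nn_integral_cong_AE)
      show "AE t in lborel. ennreal (sym_exp_density b t) * indicator A \<bar>t\<bar>
          = ennreal (1 / 2) * (F t + F (0 + (-1) * t))"
        using AE_lborel_singleton[of 0]
      proof eventually_elim
        case (elim t)
        have "sym_exp_density b t = 1 / 2 * exponential_density b \<bar>t\<bar>"
          by (simp add: sym_exp_density_def exponential_density_def mult.commute)
        then have half: "ennreal (sym_exp_density b t) = ennreal (1 / 2) * e \<bar>t\<bar>"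
          by (simp only: e_def ennreal_mult' half_gt_zero less_imp_le zero_less_one)
        have "e (- \<bar>t\<bar>) = 0"
          using elim by (simp add: e_def exponential_density_def)
        then show ?case
          by (cases "t > 0") (simp_all only: half, simp_all add: F_def mult.assoc)
      qed
    qed
    also have "\<dots> = ennreal (1 / 2) * ((\<integral>\<^sup>+t. F t \<partial>lborel) + (\<integral>\<^sup>+t. F (0 + (-1) * t) \<partial>lborel))"
      by (simp add: nn_integral_cmult nn_integral_add)
    also have "(\<integral>\<^sup>+t. F (0 + (-1) * t) \<partial>lborel) = (\<integral>\<^sup>+t. F t \<partial>lborel)"
      by (subst (2) nn_integral_real_affine[where c="-1" and t=0]) auto
    also have "ennreal (1 / 2) * ((\<integral>\<^sup>+t. F t \<partial>lborel) + (\<integral>\<^sup>+t. F t \<partial>lborel)) = (\<integral>\<^sup>+t. F t \<partial>lborel)"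
    proof -
      have "ennreal (1 / 2) * (z + z) = z" for z :: ennreal
        by (metis (no_types, lifting) ennreal_half ennreal_numeral ennreal_mult' field_sum_of_halves
            distrib_left distrib_right ennreal_plus half_gt_zero less_eq_real_def mult_1 zero_less_one ennreal_1)
      then show ?thesis .
    qed
    also have "\<dots> = emeasure (density lborel e) A"
      by (simp add: F_def emeasure_density)
    finally show "emeasure (distr N lborel (\<lambda>w. \<bar>Y w\<bar>)) A = emeasure (density lborel e) A" .
  qed simp
  then show ?thesis
    by (simp add: distributed_def e_def[abs_def])
qed

lemma exponential_AE_pos:
  assumes "prob_space M" and X: "distributed M lborel X (exponential_density b)" and "b > 0"
  shows "AE w in M. X w > 0"
proof -
  interpret prob_space M by fact
  have "prob {w \<in> space M. 0 < X w} = 1"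
    using exponential_distributedD_gt[OF X, of 0] \<open>b > 0\<close> by simp
  from AE_prob_1[OF this] show ?thesis by auto
qed

lemma exponential_integrable:
  assumes "prob_space M" and X: "distributed M lborel X (exponential_density b)" and "b > 0"
  shows "integrable M X"
  using prob_space.erlang_ith_moment_integrable[OF assms(1) \<open>b > 0\<close> X, of 1] by simp

lemma exponential_integral_eq:
  fixes F :: "real \<Rightarrow> real"
  assumes "distributed M lborel X (exponential_density b)"
    and "distributed N lborel Z (exponential_density b)"
    and "b > 0" and [measurable]: "F \<in> borel_measurable borel"
  shows "(\<integral>w. F (X w) \<partial>M) = (\<integral>w. F (Z w) \<partial>N)"
  using distributed_integral[OF assms(1), of F] distributed_integral[OF assms(2), of F]
    exponential_density_nonneg[OF \<open>b > 0\<close>] by simp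

lemma sym_exp_expectation_abs:
  assumes "prob_space N" and Y: "distributed N lborel Y (sym_exp_density b)" and "b > 0"
  shows "(\<integral>w. \<bar>Y w\<bar> \<partial>N) = 1 / b"
  using prob_space.exponential_distributed_expectation[OF assms(1) \<open>b > 0\<close>
      abs_sym_exp_distributed[OF Y \<open>b > 0\<close>]] .

lemma sym_exp_integrable:
  assumes "prob_space N" and Y: "distributed N lborel Y (sym_exp_density b)" and "b > 0"
  shows "integrable N Y"
proof -
  have "Y \<in> borel_measurable N" using distributed_measurable[OF Y] by simp
  then show ?thesis
    using exponential_integrable[OF assms(1) abs_sym_exp_distributed[OF Y \<open>b > 0\<close>] \<open>b > 0\<close>]
    by (simp add: integrable_abs_iff)
qed

lemma sym_exp_expectation:
  assumes Y: "distributed N lborel Y (sym_exp_density b)" and "b > 0"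
  shows "(\<integral>w. Y w \<partial>N) = 0"
proof -
  let ?I = "\<integral>t. sym_exp_density b t * t \<partial>lborel"
  have "?I = - ?I"
    by (subst lborel_integral_real_affine[where c="-1" and t=0]) (auto simp: sym_exp_density_def)
  moreover have "?I = (\<integral>w. Y w \<partial>N)"
    using \<open>b > 0\<close> by (intro distributed_integral[OF Y]) (auto simp: sym_exp_density_def)
  ultimately show ?thesis by simp
qed

text \<open>Fubini's theorem, applied to the region \<open>0 < t < X\<close>, turns the mean of the primitive into
  the integral of \<open>m t * P (X > t)\<close>, and \<open>P (X > t) = exp (- b * t)\<close> is the density of \<open>X\<close> up to
  the factor \<open>b\<close>. As \<open>m\<close> may jump, the primitive need not be differentiable everywhere, which is
  why the order of integration is exchanged instead of integrating by parts.\<close>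

lemma exponential_expectation_primitive:
  fixes m :: "real \<Rightarrow> real"
  assumes "prob_space M" and X: "distributed M lborel X (exponential_density b)" and "b > 0"
    and [measurable]: "m \<in> borel_measurable borel" and bound: "\<And>t. \<bar>m t\<bar> \<le> C"
  shows "integrable M (\<lambda>w. LBINT t:{0<..<X w}. m t)"
    and "(\<integral>w. (LBINT t:{0<..<X w}. m t) \<partial>M) = 1 / b * (\<integral>w. m (X w) \<partial>M)"
proof -
  interpret prob_space M by fact
  interpret P: pair_sigma_finite M lborel ..
  have [measurable]: "X \<in> borel_measurable M" using distributed_measurable[OF X] by simp
  have "C \<ge> 0" using bound[of 0] by linarith
  \<comment> \<open>\<open>D\<close> is an integrable majorant of the integrand \<open>F\<close>: its integral over \<open>t\<close> is \<open>C * max 0 X\<close>.\<close>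
  define D :: "'a \<times> real \<Rightarrow> real"
    where "D p = (if 0 < snd p \<and> snd p < X (fst p) then C else 0)" for p
  define F :: "'a \<times> real \<Rightarrow> real"
    where "F p = (if 0 < snd p \<and> snd p < X (fst p) then m (snd p) else 0)" for p
  have [measurable]: "D \<in> borel_measurable (M \<Otimes>\<^sub>M lborel)" "F \<in> borel_measurable (M \<Otimes>\<^sub>M lborel)"
    by (simp_all add: D_def[abs_def] F_def[abs_def])
  have D_ind: "D (w, t) = indicator {0<..<X w} t * C" for w t
    by (simp add: D_def split: split_indicator)
  have F_ind: "F (w, t) = indicator {0<..<X w} t * m t" for w t
    by (simp add: F_def split: split_indicator)
  have "integrable (M \<Otimes>\<^sub>M lborel) D"
  proof (rule P.Fubini_integrable)
    have "(\<integral>t. norm (D (w, t)) \<partial>lborel) = C * max 0 (X w)" for w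
      using \<open>C \<ge> 0\<close> by (simp add: D_ind abs_mult max_def)
    then show "integrable M (\<lambda>w. \<integral>t. norm (D (w, t)) \<partial>lborel)"
      using exponential_integrable[OF assms(1-3)] by simp
    have "integrable lborel (indicat_real {0<..<c})" for c :: real
      by (cases "0 \<le> c") auto
    then show "AE w in M. integrable lborel (\<lambda>t. D (w, t))"
      by (simp add: D_ind)
  qed simp
  then have F: "integrable (M \<Otimes>\<^sub>M lborel) F"
    using bound \<open>C \<ge> 0\<close> by (elim Bochner_Integration.integrable_bound) (auto simp: D_def F_def)
  have prim: "(LBINT t:{0<..<X w}. m t) = (\<integral>t. F (w, t) \<partial>lborel)" for w
    by (simp add: set_lebesgue_integral_def F_ind)
  show "integrable M (\<lambda>w. LBINT t:{0<..<X w}. m t)"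
    unfolding prim by (rule P.integrable_fst'[OF F])
  have tail: "(\<integral>w. F (w, t) \<partial>M) = 1 / b * (exponential_density b t * m t)" if "t \<noteq> 0" for t
  proof (cases "t > 0")
    case True
    have "(\<integral>w. F (w, t) \<partial>M) = (\<integral>w. indicator {w \<in> space M. t < X w} w * m t \<partial>M)"
      using True by (intro Bochner_Integration.integral_cong) (auto simp: F_def)
    also have "\<dots> = prob {w \<in> space M. t < X w} * m t"
      by simp
    also have "\<dots> = 1 / b * (exponential_density b t * m t)"
      using exponential_distributedD_gt[OF X, of t] True \<open>b > 0\<close>
      by (simp add: exponential_density_def)
    finally show ?thesis .
  next
    case False
    then show ?thesis using that by (simp add: F_def exponential_density_def)
  qed
  have "(\<integral>w. (LBINT t:{0<..<X w}. m t) \<partial>M) = (\<integral>t. (\<integral>w. F (w, t) \<partial>M) \<partial>lborel)"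
    unfolding prim using P.Fubini_integral[of "\<lambda>w t. F (w, t)"] F by simp
  also have "\<dots> = (\<integral>t. 1 / b * (exponential_density b t * m t) \<partial>lborel)"
    using AE_lborel_singleton[of 0]
    by (intro integral_cong_AE) (auto elim!: eventually_mono simp: tail)
  also have "\<dots> = 1 / b * (\<integral>t. exponential_density b t * m t \<partial>lborel)"
    by simp
  also have "(\<integral>t. exponential_density b t * m t \<partial>lborel) = (\<integral>w. m (X w) \<partial>M)"
    using \<open>b > 0\<close> by (intro distributed_integral[OF X]) (auto simp: exponential_density_nonneg)
  finally show "(\<integral>w. (LBINT t:{0<..<X w}. m t) \<partial>M) = 1 / b * (\<integral>w. m (X w) \<partial>M)" .
qed

section \<open>Symmetric functions that are monotone on the right\<close>

lemma S_class_measurable: "f \<in> S_class x \<Longrightarrow> f \<in> borel_measurable borel"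
  by (simp add: S_class_def B_class_def)

lemma S_class_bounded: "f \<in> S_class x \<Longrightarrow> \<exists>C. \<forall>y. \<bar>f y\<bar> \<le> C"
  by (auto simp: S_class_def B_class_def bounded_iff)

lemma S_class_abs: "f \<in> S_class x \<Longrightarrow> f (x + \<bar>u\<bar>) = f (x + u)"
  by (cases "u \<ge> 0") (auto simp: S_class_def)

lemma S_class_mono: "f \<in> S_class x \<Longrightarrow> \<bar>u\<bar> \<le> \<bar>v\<bar> \<Longrightarrow> f (x + u) \<le> f (x + v)"
  using mono_onD[of "{x..}" f "x + \<bar>u\<bar>" "x + \<bar>v\<bar>"]
  by (simp add: S_class_abs) (simp add: S_class_def)

lemma S_class_tendsto_right:
  assumes "f \<in> S_class x"
  shows "(f \<longlongrightarrow> rlim f x) (at_right x)"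
proof -
  obtain l where "(f \<longlongrightarrow> l) (at_right x)"
    using assms by (auto simp: S_class_def B_class_def)
  then show ?thesis
    by (simp add: rlim_def tendsto_Lim)
qed

text \<open>Reflection at \<open>x\<close> carries the right limit to the left one.\<close>

lemma S_class_tendsto_left:
  assumes f: "f \<in> S_class x"
  shows "(f \<longlongrightarrow> rlim f x) (at_left x)"
proof -
  have "((\<lambda>y. 2 * x - y) \<longlongrightarrow> 2 * x - x) (at_left x)"
    by (intro tendsto_intros)
  then have "filterlim (\<lambda>y. 2 * x - y) (at_right x) (at_left x)"
    by (auto simp: filterlim_at eventually_at_filter)
  then have "((\<lambda>y. f (2 * x - y)) \<longlongrightarrow> rlim f x) (at_left x)"
    by (rule filterlim_compose[OF S_class_tendsto_right[OF f]])
  moreover have "f (2 * x - y) = f y" for y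
    using S_class_abs[OF f, of "x - y"] S_class_abs[OF f, of "y - x"]
    by (simp add: abs_minus_commute)
  ultimately show ?thesis by simp
qed

lemma S_class_llim: "f \<in> S_class x \<Longrightarrow> llim f x = rlim f x"
  unfolding llim_def by (rule tendsto_Lim[OF _ S_class_tendsto_left]) auto

lemma rlim_le_S_class:
  assumes f: "f \<in> S_class x" and "u \<noteq> 0"
  shows "rlim f x \<le> f (x + u)"
proof (rule tendsto_upperbound[OF S_class_tendsto_right[OF f]])
  have "eventually (\<lambda>y. y \<in> {x<..<x + \<bar>u\<bar>}) (at_right x)"
    using \<open>u \<noteq> 0\<close> by (intro eventually_at_right_real) auto
  then show "eventually (\<lambda>y. f y \<le> f (x + u)) (at_right x)"
  proof eventually_elim
    case (elim y)
    then show ?case using S_class_mono[OF f, of "y - x" u] by simp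
  qed
qed simp

lemma centered_S_class:
  "f \<in> S_class x \<Longrightarrow> centered x f y = (if y = x then 0 else f y - rlim f x)"
  by (auto simp: centered_def S_class_llim split: split_indicator)

text \<open>The centered function grows with the distance to \<open>x\<close>, so the supremum is attained at the end
  point. For \<open>\<theta> < 0\<close> the modulus is the supremum of the empty set, an unspecified constant; that case
  is recorded because the measurability of \<open>modulus x (centered x f)\<close> on the whole line depends on it.\<close>

lemma modulus_centered_S_class:
  assumes f: "f \<in> S_class x"
  shows "modulus x (centered x f) \<theta> =
    (if \<theta> < 0 then Sup {} else if \<theta> = 0 then 0 else f (x + \<theta>) - rlim f x)"
proof (cases "\<theta> < 0")
  case True
  then have none: "\<not> \<bar>u\<bar> \<le> \<theta>" for u :: real by linarith
  show ?thesis using True by (simp add: modulus_def none)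
next
  case False
  let ?g = "centered x f"
  have g: "?g (x + u) = (if u = 0 then 0 else f (x + u) - rlim f x)" for u
    using f by (simp add: centered_S_class)
  have "\<bar>?g (x + u) - ?g x\<bar> \<le> ?g (x + \<theta>)" if "\<bar>u\<bar> \<le> \<theta>" for u
    using g[of u] g[of 0] g[of \<theta>] that rlim_le_S_class[OF f, of u] rlim_le_S_class[OF f, of \<theta>]
      S_class_mono[OF f, of u \<theta>] by (auto split: if_splits)
  moreover have "?g (x + \<theta>) = \<bar>?g (x + \<theta>) - ?g x\<bar>"
    using g[of \<theta>] g[of 0] rlim_le_S_class[OF f, of \<theta>] by auto
  ultimately have "Sup {\<bar>?g (x + u) - ?g x\<bar> | u. \<bar>u\<bar> \<le> \<theta>} = ?g (x + \<theta>)"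
    using False by (intro cSup_eq_maximum) (auto intro!: exI[of _ \<theta>])
  then show ?thesis using False g[of \<theta>] by (simp add: modulus_def)
qed

section \<open>The odd companion of a symmetric function\<close>

lemma odd_companion_tendsto:
  assumes f: "f \<in> S_class x"
  shows "((\<lambda>y. sgn (y - x) * f y) \<longlongrightarrow> rlim f x) (at_right x)"
    and "((\<lambda>y. sgn (y - x) * f y) \<longlongrightarrow> - rlim f x) (at_left x)"
proof -
  have "eventually (\<lambda>y. sgn (y - x) * f y = f y) (at_right x)"
    by (auto simp: eventually_at_filter)
  from tendsto_cong[OF this] S_class_tendsto_right[OF f]
  show "((\<lambda>y. sgn (y - x) * f y) \<longlongrightarrow> rlim f x) (at_right x)" by simp
  have "eventually (\<lambda>y. sgn (y - x) * f y = - f y) (at_left x)"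
    by (auto simp: eventually_at_filter)
  from tendsto_cong[OF this] tendsto_minus[OF S_class_tendsto_left[OF f]]
  show "((\<lambda>y. sgn (y - x) * f y) \<longlongrightarrow> - rlim f x) (at_left x)" by simp
qed

lemma odd_companion_rlim:
  "f \<in> S_class x \<Longrightarrow> rlim (\<lambda>y. sgn (y - x) * f y) x = rlim f x"
  unfolding rlim_def[of "\<lambda>y. sgn (y - x) * f y"]
  by (rule tendsto_Lim[OF _ odd_companion_tendsto(1)]) auto

lemma odd_companion_llim:
  "f \<in> S_class x \<Longrightarrow> llim (\<lambda>y. sgn (y - x) * f y) x = - rlim f x"
  unfolding llim_def by (rule tendsto_Lim[OF _ odd_companion_tendsto(2)]) auto

lemma odd_companion_B_class:
  assumes f: "f \<in> S_class x"
  shows "(\<lambda>y. sgn (y - x) * f y) \<in> B_class x"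
proof -
  obtain C where C: "\<And>y. \<bar>f y\<bar> \<le> C" using S_class_bounded[OF f] by auto
  have "\<bar>sgn (y - x) * f y\<bar> \<le> C" for y
    using C[of y] by (auto simp: sgn_if)
  then have "bounded (range (\<lambda>y. sgn (y - x) * f y))"
    by (auto simp: bounded_iff)
  moreover have "(\<lambda>y. sgn (y - x) * f y) \<in> borel_measurable borel"
    using S_class_measurable[OF f] by measurable
  ultimately show ?thesis
    using odd_companion_tendsto[OF f] by (auto simp: B_class_def)
qed

text \<open>The one-sided limits of the odd companion are \<open>a\<close> and \<open>- a\<close>, so centering it yields \<open>f - a\<close> to
  the right of \<open>x\<close> and \<open>a - f\<close> to the left: the centered function of \<open>f\<close> up to sign.\<close>

lemma modulus_odd_companion:
  assumes f: "f \<in> S_class x"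
  shows "modulus x (centered x (\<lambda>y. sgn (y - x) * f y)) = modulus x (centered x f)"
proof -
  have "\<bar>centered x (\<lambda>y. sgn (y - x) * f y) y\<bar> = \<bar>centered x f y\<bar>" for y
    using f
    by (simp add: centered_def odd_companion_rlim odd_companion_llim S_class_llim
        abs_minus_commute
        split: split_indicator)
  moreover have "centered x k x = 0" for k by (simp add: centered_def)
  ultimately show ?thesis by (simp add: modulus_def[abs_def])
qed

lemma tilde_eq_set_integral: "tilde x f y = (LBINT t:{0<..<\<bar>y - x\<bar>}. f (x + t))"
  by (simp add: tilde_def interval_lebesgue_integral_def zero_ereal_def)

lemma tilde_center: "tilde x f x = 0"
  by (simp add: tilde_eq_set_integral set_lebesgue_integral_def)

lemma tilde_odd_primitive:
  assumes f: "f \<in> S_class x"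
  shows "tilde x f y = (LBINT u=x..y. sgn (u - x) * f u)"
proof (cases "x \<le> y")
  case True
  have "(LBINT u=x..y. sgn (u - x) * f u)
      = (\<integral>u. indicator {x<..<y} u * (sgn (u - x) * f u) \<partial>lborel)"
    using True by (simp add: interval_lebesgue_integral_def set_lebesgue_integral_def)
  also have "\<dots> = (\<integral>t. indicator {0<..<y - x} t * f (x + t) \<partial>lborel)"
    by (subst lborel_integral_real_affine[where c=1 and t=x])
      (auto intro!: Bochner_Integration.integral_cong split: split_indicator)
  finally show ?thesis
    using True by (simp add: tilde_eq_set_integral set_lebesgue_integral_def)
next
  case False
  have sym: "f (x - t) = f (x + t)" for t using f by (simp add: S_class_def)
  have "(LBINT u=x..y. sgn (u - x) * f u)
      = - (\<integral>u. indicator {y<..<x} u * (sgn (u - x) * f u) \<partial>lborel)"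
    using False by (simp add: interval_lebesgue_integral_def set_lebesgue_integral_def)
  also have "\<dots> = - (\<integral>t. - (indicator {0<..<x - y} t * f (x + t)) \<partial>lborel)"
    by (subst lborel_integral_real_affine[where c="-1" and t=x])
      (auto intro!: Bochner_Integration.integral_cong simp: sym split: split_indicator)
  finally show ?thesis
    using False by (simp add: tilde_eq_set_integral set_lebesgue_integral_def)
qed

section \<open>Averaging\<close>

lemma S_class_expectation:
  assumes M: "prob_space M" and X: "distributed M lborel X (exponential_density b)"
    and N: "prob_space N" and Y: "distributed N lborel Y (sym_exp_density b)"
    and "b > 0" and f: "f \<in> S_class x"
  shows "integrable N (\<lambda>w. f (x + Y w))"
    and "integrable M (\<lambda>w. modulus x (centered x f) (X w))"
    and "(\<integral>w. f (x + Y w) \<partial>N) - rlim f x = (\<integral>w. modulus x (centered x f) (X w) \<partial>M)"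
    and "(\<integral>w. modulus x (centered x f) (X w) \<partial>M) \<ge> 0"
proof -
  interpret M: prob_space M by fact
  interpret N: prob_space N by fact
  note [measurable] = S_class_measurable[OF f]
  obtain C where C: "\<And>y. \<bar>f y\<bar> \<le> C" using S_class_bounded[OF f] by auto
  have [measurable]: "X \<in> borel_measurable M" "Y \<in> borel_measurable N"
    using distributed_measurable[OF X] distributed_measurable[OF Y] by auto
  have mod_meas [measurable]: "modulus x (centered x f) \<in> borel_measurable borel"
    by (subst modulus_centered_S_class[OF f, abs_def]) measurable
  show "integrable N (\<lambda>w. f (x + Y w))"
    using C by (intro N.integrable_const_bound[of _ C]) auto
  have fX: "integrable M (\<lambda>w. f (x + X w))"
    using C by (intro M.integrable_const_bound[of _ C]) auto
  \<comment> \<open>The modulus and \<open>f - a\<close> may differ at zero and on the negative half-line, which is a null set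
    for the exponential law.\<close>
  have AE: "AE w in M. modulus x (centered x f) (X w) = f (x + X w) - rlim f x"
    using exponential_AE_pos[OF M X \<open>b > 0\<close>]
    by eventually_elim (simp add: modulus_centered_S_class[OF f])
  have int_diff: "integrable M (\<lambda>w. f (x + X w) - rlim f x)"
    using fX by simp
  show "integrable M (\<lambda>w. modulus x (centered x f) (X w))"
    by (rule integrable_cong_AE_imp[OF int_diff]) (use AE in \<open>auto elim: eventually_mono\<close>)
  have "(\<integral>w. modulus x (centered x f) (X w) \<partial>M) = (\<integral>w. f (x + X w) - rlim f x \<partial>M)"
    using AE by (intro integral_cong_AE) auto
  also have "\<dots> = (\<integral>w. f (x + X w) \<partial>M) - rlim f x"
    using fX by (simp add: M.prob_space)
  also have "(\<integral>w. f (x + X w) \<partial>M) = (\<integral>w. f (x + \<bar>Y w\<bar>) \<partial>N)"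
    by (rule exponential_integral_eq[OF X abs_sym_exp_distributed[OF Y \<open>b > 0\<close>] \<open>b > 0\<close>]) measurable
  finally show "(\<integral>w. f (x + Y w) \<partial>N) - rlim f x = (\<integral>w. modulus x (centered x f) (X w) \<partial>M)"
    by (simp add: S_class_abs[OF f])
  have "AE w in M. 0 \<le> modulus x (centered x f) (X w)"
    using exponential_AE_pos[OF M X \<open>b > 0\<close>]
    by eventually_elim (simp add: modulus_centered_S_class[OF f] rlim_le_S_class[OF f])
  then show "(\<integral>w. modulus x (centered x f) (X w) \<partial>M) \<ge> 0"
    by (rule integral_nonneg_AE)
qed

lemma tilde_expectation:
  assumes N: "prob_space N" and Y: "distributed N lborel Y (sym_exp_density b)"
    and "b > 0" and f: "f \<in> S_class x"
  shows "integrable N (\<lambda>w. tilde x f (x + Y w))"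
    and "(\<integral>w. tilde x f (x + Y w) \<partial>N) = 1 / b * (\<integral>w. f (x + Y w) \<partial>N)"
proof -
  note [measurable] = S_class_measurable[OF f]
  obtain C where C: "\<And>y. \<bar>f y\<bar> \<le> C" using S_class_bounded[OF f] by auto
  have m: "(\<lambda>t. f (x + t)) \<in> borel_measurable borel" by measurable
  note P = exponential_expectation_primitive[OF N abs_sym_exp_distributed[OF Y \<open>b > 0\<close>] \<open>b > 0\<close> m, of C]
  show "integrable N (\<lambda>w. tilde x f (x + Y w))"
    using P(1) C by (simp add: tilde_eq_set_integral)
  show "(\<integral>w. tilde x f (x + Y w) \<partial>N) = 1 / b * (\<integral>w. f (x + Y w) \<partial>N)"
    using P(2) C by (simp add: tilde_eq_set_integral S_class_abs[OF f])
qed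

theorem theorem4p1:
  fixes \<beta> x :: real and n :: nat
    and M :: "'a measure" and X :: "'a \<Rightarrow> real"
    and N :: "'b measure" and Y :: "'b \<Rightarrow> real"
  assumes "\<beta> > 0" and "n \<ge> 1"
    and "prob_space M" and "distributed M lborel X (exponential_density \<beta>)"
    and "prob_space N" and "distributed N lborel Y (sym_exp_density \<beta>)"
  shows
    "(\<forall>f \<in> S_class x.
        let a = rlim f x; g = centered x f in
          llim f x = a \<and>
          integrable N (\<lambda>w. f (x + Y w / sqrt n)) \<and>
          integrable M (\<lambda>w. modulus x g (X w / sqrt n)) \<and>
          \<bar>conv_op N Y n f x - (rlim f x + llim f x) / 2\<bar>
            = \<bar>f x - llim f x\<bar> * \<P>(w in N. Y w = 0)
              + \<bar>rlim f x - llim f x\<bar> * \<bar>\<P>(w in N. Y w > 0) - 1 / 2\<bar>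
              + (\<integral>w. modulus x g (X w / sqrt n) \<partial>M) \<and>
          conv_op N Y n f x - a = (\<integral>w. modulus x g (X w / sqrt n) \<partial>M))
     \<and>
     (\<forall>\<phi> \<in> S_tilde x. \<forall>f \<in> S_class x. \<phi> = tilde x f \<longrightarrow>
        (let a = rlim f x; g = centered x f; h = (\<lambda>y. sgn (y - x) * f y) in
          llim f x = a \<and>
          h \<in> B_class x \<and>
          (\<forall>y. \<phi> y = \<phi> x + (LBINT u=x..y. h u)) \<and>
          integrable N (\<lambda>w. \<phi> (x + Y w / sqrt n)) \<and>
          integrable N Y \<and>
          integrable M (\<lambda>w. modulus x (centered x h) (X w / sqrt n)) \<and>
          integrable M (\<lambda>w. modulus x g (X w / sqrt n)) \<and>
          \<bar>conv_op N Y n \<phi> x - \<phi> x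
             - 1 / (2 * sqrt n) * (rlim h x + llim h x) * (\<integral>w. Y w \<partial>N)
             - 1 / (2 * sqrt n) * (rlim h x - llim h x) * (\<integral>w. \<bar>Y w\<bar> \<partial>N)\<bar>
            = 1 / (\<beta> * sqrt n) * (\<integral>w. modulus x (centered x h) (X w / sqrt n) \<partial>M) \<and>
          conv_op N Y n \<phi> x - a / (\<beta> * sqrt n)
            = 1 / (\<beta> * sqrt n) * (\<integral>w. modulus x g (X w / sqrt n) \<partial>M)))"
proof -
  note M = \<open>prob_space M\<close> and N = \<open>prob_space N\<close>
  note Y = \<open>distributed N lborel Y (sym_exp_density \<beta>)\<close>
  define b where "b = \<beta> * sqrt (real n)"
  have s: "sqrt (real n) > 0" using \<open>n \<ge> 1\<close> by simp
  then have b: "b > 0" using \<open>\<beta> > 0\<close> by (simp add: b_def)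
  have Xs: "distributed M lborel (\<lambda>w. X w / sqrt (real n)) (exponential_density b)"
    unfolding b_def by (rule distributed_exponential_divide) (use assms s in auto)
  have Ys: "distributed N lborel (\<lambda>w. Y w / sqrt (real n)) (sym_exp_density b)"
    unfolding b_def by (rule distributed_sym_exp_divide) (use assms s in auto)
  note E = S_class_expectation[OF M Xs N Ys b]
  note T = tilde_expectation[OF N Ys b]

  have "AE w in N. \<bar>Y w\<bar> > 0"
    by (rule exponential_AE_pos[OF N abs_sym_exp_distributed[OF Y \<open>\<beta> > 0\<close>] \<open>\<beta> > 0\<close>])
  then have "AE w in N. w \<notin> {w \<in> space N. Y w = 0}"
    by eventually_elim auto
  then have no_atom: "\<P>(w in N. Y w = 0) = 0"
    using prob_space.prob_eq_0[OF N, of "{w \<in> space N. Y w = 0}"] distributed_measurable[OF Y]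
    by (simp add: measurable_lborel1)

  show ?thesis
    unfolding Let_def conv_op_def
  proof (intro conjI ballI allI impI)
    fix f assume f: "f \<in> S_class x"
    show "llim f x = rlim f x" by (rule S_class_llim[OF f])
    show "integrable N (\<lambda>w. f (x + Y w / sqrt (real n)))" by (rule E(1)[OF f])
    show "integrable M (\<lambda>w. modulus x (centered x f) (X w / sqrt (real n)))" by (rule E(2)[OF f])
    show "\<bar>(\<integral>w. f (x + Y w / sqrt (real n)) \<partial>N) - (rlim f x + llim f x) / 2\<bar>
        = \<bar>f x - llim f x\<bar> * \<P>(w in N. Y w = 0)
          + \<bar>rlim f x - llim f x\<bar> * \<bar>\<P>(w in N. Y w > 0) - 1 / 2\<bar>
          + (\<integral>w. modulus x (centered x f) (X w / sqrt (real n)) \<partial>M)"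
      using E(3,4)[OF f] by (simp add: no_atom S_class_llim[OF f])
    show "(\<integral>w. f (x + Y w / sqrt (real n)) \<partial>N) - rlim f x
        = (\<integral>w. modulus x (centered x f) (X w / sqrt (real n)) \<partial>M)" by (rule E(3)[OF f])
  next
    fix \<phi> f assume f: "f \<in> S_class x" and \<phi>: "\<phi> = tilde x f"
    let ?h = "\<lambda>y. sgn (y - x) * f y"
    let ?\<omega> = "\<integral>w. modulus x (centered x f) (X w / sqrt (real n)) \<partial>M"
    show "llim f x = rlim f x" by (rule S_class_llim[OF f])
    show "?h \<in> B_class x" by (rule odd_companion_B_class[OF f])
    show "\<phi> y = \<phi> x + (LBINT u=x..y. ?h u)" for y
      unfolding \<phi> tilde_center by (simp add: tilde_odd_primitive[OF f])
    show "integrable N (\<lambda>w. \<phi> (x + Y w / sqrt (real n)))" unfolding \<phi> by (rule T(1)[OF f])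
    show "integrable N Y" by (rule sym_exp_integrable[OF N Y \<open>\<beta> > 0\<close>])
    show "integrable M (\<lambda>w. modulus x (centered x f) (X w / sqrt (real n)))" by (rule E(2)[OF f])
    then show "integrable M (\<lambda>w. modulus x (centered x ?h) (X w / sqrt (real n)))"
      by (simp add: modulus_odd_companion[OF f])
    have "(\<integral>w. \<phi> (x + Y w / sqrt (real n)) \<partial>N) = 1 / b * (rlim f x + ?\<omega>)"
      unfolding \<phi> T(2)[OF f] using E(3)[OF f] by simp
    then show main: "(\<integral>w. \<phi> (x + Y w / sqrt (real n)) \<partial>N) - rlim f x / (\<beta> * sqrt (real n))
        = 1 / (\<beta> * sqrt (real n)) * ?\<omega>"
      by (simp add: b_def add_divide_distrib)
    have "(\<integral>w. \<phi> (x + Y w / sqrt (real n)) \<partial>N) - \<phi> x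
          - 1 / (2 * sqrt (real n)) * (rlim ?h x + llim ?h x) * (\<integral>w. Y w \<partial>N)
          - 1 / (2 * sqrt (real n)) * (rlim ?h x - llim ?h x) * (\<integral>w. \<bar>Y w\<bar> \<partial>N)
        = (\<integral>w. \<phi> (x + Y w / sqrt (real n)) \<partial>N) - rlim f x / (\<beta> * sqrt (real n))"
      unfolding odd_companion_rlim[OF f] odd_companion_llim[OF f]
        sym_exp_expectation[OF Y \<open>\<beta> > 0\<close>] sym_exp_expectation_abs[OF N Y \<open>\<beta> > 0\<close>]
      by (simp add: \<phi> tilde_center mult.commute)
    then have "\<bar>(\<integral>w. \<phi> (x + Y w / sqrt (real n)) \<partial>N) - \<phi> x
          - 1 / (2 * sqrt (real n)) * (rlim ?h x + llim ?h x) * (\<integral>w. Y w \<partial>N)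
          - 1 / (2 * sqrt (real n)) * (rlim ?h x - llim ?h x) * (\<integral>w. \<bar>Y w\<bar> \<partial>N)\<bar>
        = \<bar>1 / (\<beta> * sqrt (real n)) * ?\<omega>\<bar>"
      by (simp only: main)
    also have "\<dots> = 1 / (\<beta> * sqrt (real n)) * ?\<omega>"
      using E(4)[OF f] b by (simp add: b_def)
    finally show "\<bar>(\<integral>w. \<phi> (x + Y w / sqrt (real n)) \<partial>N) - \<phi> x
          - 1 / (2 * sqrt (real n)) * (rlim ?h x + llim ?h x) * (\<integral>w. Y w \<partial>N)
          - 1 / (2 * sqrt (real n)) * (rlim ?h x - llim ?h x) * (\<integral>w. \<bar>Y w\<bar> \<partial>N)\<bar>
        = 1 / (\<beta> * sqrt (real n)) * (\<integral>w. modulus x (centered x ?h) (X w / sqrt (real n)) \<partial>M)"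
      by (simp add: modulus_odd_companion[OF f])
  qed
qed

end
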